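(* Let $n\ge1$ be an integer and define $\varepsilon_n>0$ by $(1+\varepsilon_n)^2 = 1+8190\,e^{-n/10}$. Then $$|f(0)| \le (1+\varepsilon_n)\,3n\,\left\|f(t)e^{-9nt/2}\right\|_{L_2[0,1]}\qquad\text{for every } f\in\mathcal{T}_n,$$ and for every choice of real numbers $\lambda_1<\lambda_2<\cdots<\lambda_n$ there exists $f(t)=\sum_{j=1}^n a_je^{i\lambda_jt}$ with $a_j\in\mathbb{C}$ such that $$|f(0)| > 3n\,\left\|f(t)e^{-9nt/2}\right\|_{L_2[0,1]}.$$
   Context: $\mathcal{T}_n$ denotes the set of all functions $f(t)=\sum_{j=1}^n a_j e^{i\lambda_j t}$ ($t\in\mathbb{R}$) with $a_j\in\mathbb{C}$ (possibly zero) and real $\lambda_1<\cdots<\lambda_n$. $\|f(t)e^{-9nt/2}\|_{L_2[0,1]} = (\int_0^1|f(t)|^2e^{-9nt}\,dt)^{1/2}$. *)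

theory Defs
  imports "HOL-Analysis.Analysis"
begin

definition expsum :: "nat \<Rightarrow> (nat \<Rightarrow> complex) \<Rightarrow> (nat \<Rightarrow> real) \<Rightarrow> real \<Rightarrow> complex" where
  "expsum n a lam t = (\<Sum>j<n. a j * exp (\<i> * complex_of_real (lam j * t)))"

definition wnorm :: "nat \<Rightarrow> (real \<Rightarrow> complex) \<Rightarrow> real" where
  "wnorm n f = sqrt (integral {0..1} (\<lambda>t. (cmod (f t))\<^sup>2 * exp (- 9 * real n * t)))"

definition eps :: "nat \<Rightarrow> real" where
  "eps n = sqrt (1 + 8190 * exp (- real n / 10)) - 1"

end

theory Submission
  imports Defs
begin

text \<open>
  Put \<open>p\<^sub>j = 9n/2 - i \<lambda>\<^sub>j\<close>, so that \<open>f(t) exp(-9nt/2) = \<Sum> a\<^sub>j exp(-p\<^sub>j t)\<close>. On the whole half-line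
  \<open>[0,\<infinity>)\<close> the extremal problem is solved exactly: the largest value of \<open>|f(0)|\<^sup>2\<close> for \<open>L\<^sub>2\<close> norm 1 is
  \<open>\<Sum> 2 Re p\<^sub>j = 9n\<^sup>2\<close>. This follows by removing one exponent at a time from the Cauchy form
  \<open>\<Sum>\<Sum> a\<^sub>j cnj(a\<^sub>k) / (p\<^sub>j + cnj(p\<^sub>k))\<close>, which is the squared norm (the Malmquist-Takenaka
  construction). The norm over \<open>[0,1]\<close> is smaller, strictly so for the extremal \<open>f\<close>.

  For the converse the tail over \<open>[1,\<infinity>)\<close> has to be small. A Turan-type inequality bounds \<open>f\<close> at a
  late point of an arithmetic progression by its values at the first \<open>n\<close> points; averaging over
  the starting point of progressions of step \<open>1/(4n)\<close> turns it into a bound for \<open>L\<^sub>2\<close> norms,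
  in which the weight outweighs the growth.
\<close>

section \<open>Turan-type extrapolation of power sums\<close>

text \<open>
  The induction on \<open>n\<close> eliminates the last base: \<open>g(k + 1) - z\<^sub>n g(k)\<close> is a power sum in the remaining
  bases, and the ratios \<open>A = 8\<close>, \<open>r = 4/3\<close> are chosen so that \<open>A = 2 r / (r - 1)\<close>.
\<close>

lemma power_sum_extrapolation:
  fixes b z :: "nat \<Rightarrow> complex"
  assumes "\<And>j. cmod (z j) \<le> 1" "0 \<le> M"
    and "\<And>k. k < n \<Longrightarrow> cmod (\<Sum>j<n. b j * z j ^ k) \<le> M"
  shows "cmod (\<Sum>j<n. b j * z j ^ (n + m)) \<le> 8 ^ n * (4/3) ^ m * M"
  using assms(2,3)
proof (induction n arbitrary: b M m)
  case 0
  then show ?case by simp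
next
  case (Suc n)
  define g where "g k = (\<Sum>j<Suc n. b j * z j ^ k)" for k
  define h where "h k = (\<Sum>j<n. (b j * (z j - z n)) * z j ^ k)" for k
  have g_M: "cmod (g k) \<le> M" if "k < Suc n" for k
    using Suc.prems(2)[OF that] by (simp add: g_def)
  have g_Suc: "g (Suc k) = z n * g k + h k" for k
    by (simp add: g_def h_def sum_distrib_left algebra_simps flip: sum.distrib)
  have zg: "cmod (z n * g k) \<le> cmod (g k)" for k
    using assms(1)[of n] by (simp add: norm_mult mult_left_le_one_le)
  have h_le: "cmod (h k) \<le> 2 * M" if "k < n" for k
  proof -
    have "h k = g (Suc k) - z n * g k" by (simp add: g_Suc)
    then have "cmod (h k) \<le> cmod (g (Suc k)) + cmod (z n * g k)"
      by (simp add: norm_triangle_ineq4)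
    with zg[of k] g_M[of k] g_M[of "Suc k"] that show ?thesis by simp
  qed
  have h_ext: "cmod (h (n + m)) \<le> 8 ^ n * (4/3) ^ m * (2 * M)" for m
    using Suc.IH[of "2 * M" "\<lambda>j. b j * (z j - z n)" m] Suc.prems(1) h_le
    by (simp add: h_def)
  \<comment> \<open>Solves the recursion \<open>g_Suc\<close>: the increment
    \<open>2 * M * 8 ^ n * (4/3) ^ m\<close> is the difference of consecutive values of
    \<open>6 * M * 8 ^ n * (4/3) ^ m\<close>, which is where the 6 comes from.\<close>
  have claim: "cmod (g (n + m)) \<le> M + 6 * M * 8 ^ n * ((4/3) ^ m - 1)" for m
  proof (induction m)
    case 0
    then show ?case using g_M[of n] by simp
  next
    case (Suc m)
    have "cmod (g (n + Suc m)) \<le> cmod (g (n + m)) + cmod (h (n + m))"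
      using norm_triangle_ineq[of "z n * g (n + m)" "h (n + m)"] zg[of "n + m"]
      by (simp add: g_Suc)
    with Suc h_ext[of m] show ?case by (simp add: algebra_simps)
  qed
  \<comment> \<open>The claim is applied at \<open>Suc m\<close> because
    \<open>Suc n + m = n + Suc m\<close>. Then \<open>6 * (4/3) = 8\<close> yields the main term,
    and the leftover \<open>M\<close> is absorbed by \<open>- 6 * M * 8 ^ n\<close>.\<close>
  have "M \<le> 8 ^ n * M" using Suc.prems(1) by (simp add: mult_le_cancel_right1)
  then have "M \<le> 6 * M * 8 ^ n" using Suc.prems(1) by (simp add: algebra_simps)
  with claim[of "Suc m"] show ?case by (simp add: g_def algebra_simps)
qed

text \<open>Each of the first \<open>n\<close> values is at most the root of their sum of squares,
  which serves as \<open>M\<close>. The squared form can be integrated over the starting point of a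
  progression.\<close>

lemma power_sum_extrapolation_l2:
  fixes b z :: "nat \<Rightarrow> complex"
  assumes "\<And>j. cmod (z j) \<le> 1"
  shows "(cmod (\<Sum>j<n. b j * z j ^ (n + m)))\<^sup>2
    \<le> 64 ^ n * (16/9) ^ m * (\<Sum>k<n. (cmod (\<Sum>j<n. b j * z j ^ k))\<^sup>2)" (is "_ \<le> _ * ?Q")
proof -
  have "cmod (\<Sum>j<n. b j * z j ^ (n + m)) \<le> 8 ^ n * (4/3) ^ m * sqrt ?Q"
  proof (rule power_sum_extrapolation[OF assms])
    show "0 \<le> sqrt ?Q" by (simp add: sum_nonneg)
    fix k assume "k < n"
    then have "(cmod (\<Sum>j<n. b j * z j ^ k))\<^sup>2 \<le> ?Q"
      by (intro member_le_sum[where f = "\<lambda>k. (cmod (\<Sum>j<n. b j * z j ^ k))\<^sup>2"]) auto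
    then show "cmod (\<Sum>j<n. b j * z j ^ k) \<le> sqrt ?Q" by (rule real_le_rsqrt)
  qed
  then have "(cmod (\<Sum>j<n. b j * z j ^ (n + m)))\<^sup>2 \<le> (8 ^ n * (4/3) ^ m * sqrt ?Q)\<^sup>2"
    by (rule power_mono) simp
  also have "\<dots> = (8\<^sup>2) ^ n * ((4/3)\<^sup>2) ^ m * ?Q"
    by (simp only: power_mult_distrib power_mult[symmetric] mult.commute[of 2])
      (simp add: sum_nonneg)
  finally show ?thesis by (simp add: power2_eq_square)
qed

section \<open>The Cauchy form and its extremal problem\<close>

text \<open>\<open>1 / (p j + cnj (p k))\<close> is the inner product of
  \<open>exp (- p j * t)\<close> and \<open>exp (- p k * t)\<close> on the half-line when the real
  parts are positive.\<close>

definition cauchy_form :: "(nat \<Rightarrow> complex) \<Rightarrow> nat \<Rightarrow> (nat \<Rightarrow> complex) \<Rightarrow> complex" where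
  "cauchy_form p n a = (\<Sum>j<n. \<Sum>k<n. a j * cnj (a k) / (p j + cnj (p k)))"

lemma add_cnj_nonzero:
  assumes "Re p > 0" "Re q > 0"
  shows "p + cnj q \<noteq> 0" "cnj p + q \<noteq> 0"
  using assms by (auto simp: complex_eq_iff)

text \<open>
  In terms of Laplace transforms, \<open>\<Sum> a\<^sub>j / (s + p\<^sub>j)\<close> is written as a multiple of \<open>1 / (s + p\<^sub>n)\<close> plus
  the all-pass factor \<open>(s - cnj(p\<^sub>n)) / (s + p\<^sub>n)\<close> times a transform with one exponent fewer; the two
  parts are orthogonal.
\<close>

lemma sum_peel:
  assumes "\<And>j. Re (p j) > 0"
  shows "(\<Sum>j<Suc n. a j) = (\<Sum>j<n. a j * (p j - p n) / (p j + cnj (p n)))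
    + (p n + cnj (p n)) * (\<Sum>j<Suc n. a j / (p j + cnj (p n)))"
proof -
  have "a j = a j * (p j - p n) / (p j + cnj (p n)) + (p n + cnj (p n)) * (a j / (p j + cnj (p n)))" for j
    using add_cnj_nonzero[OF assms assms, of j n] by (simp add: divide_simps) (simp add: algebra_simps)
  then have "(\<Sum>j<Suc n. a j) = (\<Sum>j<Suc n. a j * (p j - p n) / (p j + cnj (p n)))
    + (p n + cnj (p n)) * (\<Sum>j<Suc n. a j / (p j + cnj (p n)))"
    unfolding sum_distrib_left sum.distrib[symmetric] by (intro sum.cong) auto
  then show ?thesis by simp
qed

text \<open>Clearing denominators leaves
  \<open>(u + q) * (v + p) - (u - p) * (v - q) = (p + q) * (u + v)\<close>. The last summand
  separates \<open>u\<close> from \<open>v\<close>, so it contributes a rank-one form.\<close>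

lemma cauchy_kernel_peel:
  fixes u v x p q :: complex
  assumes "u + v \<noteq> 0" "u + q \<noteq> 0" "v + p \<noteq> 0"
  shows "1 / (u + v) = ((u - p) / (u + q)) * ((v - q) / (v + p)) / (u + v)
    + (p + q) * (1 / (u + q)) * (1 / (v + p))"
  using assms by (simp add: divide_simps) (simp add: algebra_simps)

text \<open>Pythagoras for this splitting: \<open>s\<close> is the inner product of the exponential
  sum with \<open>exp (- p n * t)\<close>. The kernel identity is summed over all pairs, and the new
  coefficient at index \<open>n\<close> vanishes, which leaves only \<open>n\<close>
  exponents.\<close>

lemma cauchy_form_peel:
  fixes p a :: "nat \<Rightarrow> complex" and n :: nat
  assumes pos: "\<And>j. Re (p j) > 0"
  defines "s \<equiv> \<Sum>j<Suc n. a j / (p j + cnj (p n))"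
  shows "cauchy_form p (Suc n) a
    = cauchy_form p n (\<lambda>j. a j * (p j - p n) / (p j + cnj (p n)))
      + (p n + cnj (p n)) * (s * cnj s)"
proof -
  define g where "g j = a j * (p j - p n) / (p j + cnj (p n))" for j
  have gn: "g n = 0" by (simp add: g_def)
  have split: "a j * cnj (a k) / (p j + cnj (p k)) = g j * cnj (g k) / (p j + cnj (p k))
      + (p n + cnj (p n)) * ((a j / (p j + cnj (p n))) * cnj (a k / (p k + cnj (p n))))" for j k
  proof -
    have "a j * cnj (a k) / (p j + cnj (p k)) = a j * cnj (a k) * (1 / (p j + cnj (p k)))" by simp
    also have "\<dots> = a j * cnj (a k) * (((p j - p n) / (p j + cnj (p n)))
        * ((cnj (p k) - cnj (p n)) / (cnj (p k) + p n)) / (p j + cnj (p k))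
        + (p n + cnj (p n)) * (1 / (p j + cnj (p n))) * (1 / (cnj (p k) + p n)))"
      by (subst cauchy_kernel_peel[of "p j" "cnj (p k)" "cnj (p n)" "p n"])
        (use add_cnj_nonzero[OF pos pos] in auto)
    also have "\<dots> = g j * cnj (g k) / (p j + cnj (p k))
      + (p n + cnj (p n)) * ((a j / (p j + cnj (p n))) * cnj (a k / (p k + cnj (p n))))"
      unfolding g_def by (simp add: algebra_simps)
    finally show ?thesis .
  qed
  have "cauchy_form p (Suc n) a = (\<Sum>j<Suc n. \<Sum>k<Suc n. g j * cnj (g k) / (p j + cnj (p k)))
     + (\<Sum>j<Suc n. \<Sum>k<Suc n. (p n + cnj (p n)) * ((a j / (p j + cnj (p n))) * cnj (a k / (p k + cnj (p n)))))"
    unfolding cauchy_form_def sum.distrib[symmetric] by (intro sum.cong refl split)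
  also have "(\<Sum>j<Suc n. \<Sum>k<Suc n. g j * cnj (g k) / (p j + cnj (p k))) = cauchy_form p n g"
    by (simp add: cauchy_form_def gn)
  also have "(\<Sum>j<Suc n. \<Sum>k<Suc n. (p n + cnj (p n)) * ((a j / (p j + cnj (p n))) * cnj (a k / (p k + cnj (p n)))))
     = (p n + cnj (p n)) * (s * cnj s)"
    by (simp only: s_def cnj_sum sum_product) (simp only: sum_distrib_left)
  finally show ?thesis unfolding g_def .
qed

text \<open>Cauchy-Schwarz for the vectors \<open>(sqrt S, sqrt r)\<close> and
  \<open>(sqrt N, sqrt r * s)\<close>, as \<open>g\<close> is at most
  \<open>sqrt S * sqrt N\<close>.\<close>

lemma weighted_cauchy_schwarz:
  fixes g s S N r :: real
  assumes "g\<^sup>2 \<le> S * N" "0 \<le> S" "0 \<le> N" "0 \<le> r" "0 \<le> g" "0 \<le> s"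
  shows "(g + r * s)\<^sup>2 \<le> (S + r) * (N + r * s\<^sup>2)"
proof -
  have "g \<le> sqrt S * sqrt N" using assms by (simp add: real_le_rsqrt flip: real_sqrt_mult)
  then have "2 * g * s \<le> 2 * (sqrt S * sqrt N) * s" using assms by (simp add: mult_right_mono)
  also have "\<dots> \<le> (sqrt S * s)\<^sup>2 + (sqrt N)\<^sup>2"
    using sum_squares_bound[of "sqrt S * s" "sqrt N"] by (simp add: mult_ac)
  also have "\<dots> = S * s\<^sup>2 + N" using assms by (simp add: power_mult_distrib)
  finally have "r * (2 * g * s) \<le> r * (S * s\<^sup>2 + N)" using assms by (simp add: mult_left_mono)
  with assms(1) show ?thesis by (simp add: power2_eq_square algebra_simps)
qed

text \<open>Peeling adds \<open>r * s\<close> to the coefficient sum and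
  \<open>r * (cmod s)\<^sup>2\<close> to the form, with \<open>r = 2 * Re (p n)\<close>.
  Nonnegativity is carried through the induction because the Cauchy-Schwarz step needs it.\<close>

lemma cauchy_form_bound:
  fixes p a :: "nat \<Rightarrow> complex"
  assumes pos: "\<And>j. Re (p j) > 0"
  shows "0 \<le> Re (cauchy_form p n a) \<and>
    (cmod (\<Sum>j<n. a j))\<^sup>2 \<le> (\<Sum>j<n. 2 * Re (p j)) * Re (cauchy_form p n a)"
proof (induction n arbitrary: a)
  case 0
  then show ?case by (simp add: cauchy_form_def)
next
  case (Suc n)
  define g where "g = (\<lambda>j. a j * (p j - p n) / (p j + cnj (p n)))"
  define s where "s = (\<Sum>j<Suc n. a j / (p j + cnj (p n)))"
  define r where "r = 2 * Re (p n)"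
  have r: "p n + cnj (p n) = complex_of_real r" "0 \<le> r"
    using pos[of n] by (auto simp: r_def complex_add_cnj)
  have form: "Re (cauchy_form p (Suc n) a) = Re (cauchy_form p n g) + r * (cmod s)\<^sup>2"
    using cauchy_form_peel[of p n a, OF pos]
    unfolding g_def[symmetric] s_def[symmetric] r(1) complex_norm_square[symmetric] by simp
  have "cmod (\<Sum>j<Suc n. a j) = cmod ((\<Sum>j<n. g j) + complex_of_real r * s)"
    using sum_peel[of p a n, OF pos] unfolding g_def s_def r(1) by simp
  also have "\<dots> \<le> cmod (\<Sum>j<n. g j) + r * cmod s"
    using norm_triangle_ineq[of "\<Sum>j<n. g j" "complex_of_real r * s"] r(2) by (simp add: norm_mult)
  finally have "(cmod (\<Sum>j<Suc n. a j))\<^sup>2 \<le> (cmod (\<Sum>j<n. g j) + r * cmod s)\<^sup>2"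
    by (rule power_mono) simp
  also have "\<dots> \<le> ((\<Sum>j<n. 2 * Re (p j)) + r) * (Re (cauchy_form p n g) + r * (cmod s)\<^sup>2)"
    by (rule weighted_cauchy_schwarz)
      (use Suc.IH[of g] r(2) pos in \<open>auto intro!: sum_nonneg simp: less_imp_le\<close>)
  finally show ?case
    using Suc.IH[of g] r(2) by (auto simp: form r_def)
qed

text \<open>Equality persists when \<open>s = 1\<close>: the sum and the form then both grow by
  \<open>r\<close>. The peeling map on coefficients is inverted, dividing by
  \<open>p j - p n\<close>, which is nonzero by injectivity.\<close>

lemma cauchy_form_extremal:
  fixes p :: "nat \<Rightarrow> complex"
  assumes pos: "\<And>j. Re (p j) > 0" and "inj_on p {..<n}"
  shows "\<exists>a. (\<Sum>j<n. a j) = complex_of_real (\<Sum>j<n. 2 * Re (p j)) \<and>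
    cauchy_form p n a = complex_of_real (\<Sum>j<n. 2 * Re (p j))"
  using assms(2)
proof (induction n)
  case 0
  then show ?case by (simp add: cauchy_form_def)
next
  case (Suc n)
  let ?S = "\<Sum>j<n. 2 * Re (p j)"
  from Suc.prems have "inj_on p {..<n}" by (rule inj_on_subset) auto
  with Suc.IH obtain g where g: "(\<Sum>j<n. g j) = complex_of_real ?S"
      "cauchy_form p n g = complex_of_real ?S" by blast
  define r where "r = 2 * Re (p n)"
  have r: "p n + cnj (p n) = complex_of_real r" by (simp add: r_def complex_add_cnj)
  define b where "b = (\<lambda>j. g j * (p j + cnj (p n)) / (p j - p n))"
  \<comment> \<open>The last coefficient is free, since peeling discards it; it is chosen to solve
    \<open>s = 1\<close>.\<close>
  define a where "a = b(n := (p n + cnj (p n)) * (1 - (\<Sum>j<n. b j / (p j + cnj (p n)))))"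
  have ag: "a j * (p j - p n) / (p j + cnj (p n)) = g j" if "j < n" for j
  proof -
    have "p j \<noteq> p n" using Suc.prems that by (auto simp: inj_on_def)
    then show ?thesis using that add_cnj_nonzero[OF pos pos, of j n] by (simp add: a_def b_def)
  qed
  have s: "(\<Sum>j<Suc n. a j / (p j + cnj (p n))) = 1"
    using add_cnj_nonzero[OF pos pos, of n n] by (simp add: a_def)
  have "(\<Sum>j<Suc n. a j) = (\<Sum>j<n. g j) + complex_of_real r"
    using sum_peel[of p a n, OF pos] unfolding s r by (simp add: ag cong: sum.cong_simp)
  moreover have "cauchy_form p (Suc n) a = cauchy_form p n g + complex_of_real r"
  proof -
    have "cauchy_form p n (\<lambda>j. a j * (p j - p n) / (p j + cnj (p n))) = cauchy_form p n g"
      unfolding cauchy_form_def using ag by (intro sum.cong refl) simp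
    then show ?thesis unfolding cauchy_form_peel[of p n a, OF pos] s r by simp
  qed
  ultimately show ?case using g by (intro exI[of _ a]) (simp add: r_def)
qed

section \<open>The Cauchy form as a limit of integrals\<close>

lemma has_integral_exp_complex:
  assumes "c \<noteq> 0" "0 \<le> T"
  shows "((\<lambda>t. exp (- c * complex_of_real t)) has_integral (1 - exp (- c * of_real T)) / c) {0..T}"
proof -
  have "((\<lambda>t. exp (- c * complex_of_real t)) has_integral
      (- exp (- c * of_real T) / c) - (- exp (- c * of_real 0) / c)) {0..T}"
  proof (rule fundamental_theorem_of_calculus[OF assms(2)])
    fix x
    have "((\<lambda>z. - exp (- c * z) / c) has_field_derivative exp (- c * of_real x)) (at (of_real x))"
      using assms(1) by (auto intro!: derivative_eq_intros)
    then show "((\<lambda>t. - exp (- c * complex_of_real t) / c) has_vector_derivative exp (- c * complex_of_real x))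
        (at x within {0..T})"
      by (rule has_vector_derivative_real_field[THEN has_vector_derivative_at_within])
  qed
  then show ?thesis by (simp add: diff_divide_distrib)
qed

lemma has_integral_norm_square_exp_sum:
  fixes p a :: "nat \<Rightarrow> complex"
  assumes pos: "\<And>j. Re (p j) > 0" and "0 \<le> T"
  shows "((\<lambda>t. (cmod (\<Sum>j<n. a j * exp (- p j * of_real t)))\<^sup>2) has_integral
    Re (\<Sum>j<n. \<Sum>k<n. a j * cnj (a k) *
      ((1 - exp (- (p j + cnj (p k)) * of_real T)) / (p j + cnj (p k))))) {0..T}"
proof -
  have eq: "(cmod (\<Sum>j<n. a j * exp (- p j * of_real t)))\<^sup>2
      = Re (\<Sum>j<n. \<Sum>k<n. a j * cnj (a k) * exp (- (p j + cnj (p k)) * of_real t))" for t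
  proof -
    let ?E = "\<Sum>j<n. a j * exp (- p j * of_real t)"
    have "complex_of_real ((cmod ?E)\<^sup>2) = ?E * cnj ?E"
      by (rule complex_norm_square)
    also have "\<dots> = (\<Sum>j<n. \<Sum>k<n. a j * cnj (a k) * exp (- (p j + cnj (p k)) * of_real t))"
      unfolding cnj_sum sum_product
      by (intro sum.cong refl) (simp add: exp_cnj algebra_simps exp_add[symmetric])
    finally show ?thesis by (metis Re_complex_of_real)
  qed
  show ?thesis unfolding eq
    by (intro has_integral_linear[OF _ bounded_linear_Re, unfolded o_def] has_integral_sum
        has_integral_mult_right has_integral_exp_complex finite_lessThan assms(2) add_cnj_nonzero pos)
qed

lemma integral_norm_square_exp_sum_tendsto:
  fixes p a :: "nat \<Rightarrow> complex"
  assumes pos: "\<And>j. Re (p j) > 0"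
  shows "((\<lambda>T. integral {0..T} (\<lambda>t. (cmod (\<Sum>j<n. a j * exp (- p j * of_real t)))\<^sup>2))
    \<longlongrightarrow> Re (cauchy_form p n a)) at_top"
proof -
  have exp0: "((\<lambda>T. exp (- c * complex_of_real T)) \<longlongrightarrow> 0) at_top" if "Re c > 0" for c
  proof (rule tendsto_norm_zero_cancel)
    have "filterlim (\<lambda>T. Re c * T) at_top at_top"
      using that by (intro filterlim_tendsto_pos_mult_at_top[OF tendsto_const]) (auto simp: filterlim_ident)
    then have "((\<lambda>T. exp (- (Re c * T))) \<longlongrightarrow> 0) at_top"
      by (intro filterlim_compose[OF exp_at_bot] filterlim_uminus_at_bot[THEN iffD2]) simp
    then show "((\<lambda>T. cmod (exp (- c * complex_of_real T))) \<longlongrightarrow> 0) at_top"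
      by (simp add: norm_exp_eq_Re)
  qed
  have "((\<lambda>T. Re (\<Sum>j<n. \<Sum>k<n. a j * cnj (a k) *
      ((1 - exp (- (p j + cnj (p k)) * of_real T)) / (p j + cnj (p k)))))
    \<longlongrightarrow> Re (\<Sum>j<n. \<Sum>k<n. a j * cnj (a k) * ((1 - 0) / (p j + cnj (p k))))) at_top"
    by (intro tendsto_intros exp0 add_cnj_nonzero pos) (use pos in \<open>simp add: add_pos_pos\<close>)
  moreover have "\<forall>\<^sub>F T in at_top. Re (\<Sum>j<n. \<Sum>k<n. a j * cnj (a k) *
      ((1 - exp (- (p j + cnj (p k)) * of_real T)) / (p j + cnj (p k))))
    = integral {0..T} (\<lambda>t. (cmod (\<Sum>j<n. a j * exp (- p j * of_real t)))\<^sup>2)"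
    using eventually_ge_at_top[of 0]
    by eventually_elim (rule integral_unique[symmetric], rule has_integral_norm_square_exp_sum[OF pos])
  ultimately show ?thesis
    unfolding cauchy_form_def by (auto elim: Lim_transform_eventually)
qed

section \<open>Decay of the weighted square beyond 1\<close>

definition weighted_square :: "nat \<Rightarrow> (nat \<Rightarrow> complex) \<Rightarrow> (nat \<Rightarrow> real) \<Rightarrow> real \<Rightarrow> real" where
  "weighted_square n a lam t = (cmod (expsum n a lam t))\<^sup>2 * exp (- 9 * real n * t)"

lemma weighted_square_nonneg: "0 \<le> weighted_square n a lam t"
  by (simp add: weighted_square_def)

lemma continuous_on_weighted_square: "continuous_on S (weighted_square n a lam)"
  unfolding weighted_square_def expsum_def by (intro continuous_intros)

lemma integrable_weighted_square:
  "weighted_square n a lam integrable_on {s..t}"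
  by (intro integrable_continuous_interval continuous_on_weighted_square)

lemma expsum_step:
  "expsum n a lam (u + real k * h) =
    (\<Sum>j<n. (a j * exp (\<i> * complex_of_real (lam j * u))) * exp (\<i> * complex_of_real (lam j * h)) ^ k)"
  unfolding expsum_def
  by (intro sum.cong refl) (simp add: exp_of_nat_mult[symmetric] exp_add[symmetric] algebra_simps)

text \<open>Along a progression an exponential sum is a power sum with bases of modulus 1. The step
  \<open>h\<close> may be negative, which allows extrapolation backwards.\<close>

lemma expsum_extrapolation:
  "(cmod (expsum n a lam (u + real (n + m) * h)))\<^sup>2
    \<le> 64 ^ n * (16/9) ^ m * (\<Sum>k<n. (cmod (expsum n a lam (u + real k * h)))\<^sup>2)"
  unfolding expsum_step by (rule power_sum_extrapolation_l2) (simp add: norm_exp_i_times)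

text \<open>With step \<open>1 / (4 * n)\<close> the weight falls by \<open>exp (-9/4)\<close> per
  step, against growth 16/9. Every sample \<open>k < n\<close> lies at least \<open>m\<close> steps
  before the target.\<close>

lemma weighted_square_extrapolation:
  assumes "0 \<le> u" "n \<ge> 1" and h: "h = 1 / (4 * real n)"
  shows "weighted_square n a lam (u + real (n + m) * h)
    \<le> 64 ^ n * (16/9 * exp (-9/4)) ^ m * (\<Sum>k<n. weighted_square n a lam (u + real k * h))"
proof -
  let ?e = "\<lambda>t. exp (- 9 * real n * t)" and ?F = "\<lambda>k. (cmod (expsum n a lam (u + real k * h)))\<^sup>2"
  have nh: "9 * real n * h = 9/4" using assms by simp
  have exp_le: "?e (u + real (n + m) * h) \<le> exp (-9/4) ^ m * ?e (u + real k * h)" if "k < n" for k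
  proof -
    have "9 * real n * (real k * h) \<le> 9 * real n * (real n * h)"
      using that assms by (intro mult_left_mono mult_right_mono) auto
    moreover have "9 * real n * (real m * h) = real m * (9/4)" using nh by (simp add: algebra_simps)
    ultimately have "- 9 * real n * (u + real (n + m) * h) \<le> real m * (-9/4) + - 9 * real n * (u + real k * h)"
      unfolding of_nat_add ring_distribs by linarith
    then show ?thesis by (simp only: exp_of_nat_mult[symmetric] exp_add[symmetric] exp_le_cancel_iff)
  qed
  have "weighted_square n a lam (u + real (n + m) * h)
      \<le> 64 ^ n * (16/9) ^ m * (\<Sum>k<n. ?F k) * ?e (u + real (n + m) * h)"
    unfolding weighted_square_def by (intro mult_right_mono expsum_extrapolation) simp
  also have "\<dots> = 64 ^ n * (16/9) ^ m * (\<Sum>k<n. ?F k * ?e (u + real (n + m) * h))"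
    by (simp only: sum_distrib_right mult.assoc)
  also have "\<dots> \<le> 64 ^ n * (16/9) ^ m * (\<Sum>k<n. ?F k * (exp (-9/4) ^ m * ?e (u + real k * h)))"
    using exp_le by (intro mult_left_mono sum_mono) auto
  also have "\<dots> = 64 ^ n * (16/9 * exp (-9/4)) ^ m * (\<Sum>k<n. weighted_square n a lam (u + real k * h))"
    unfolding weighted_square_def power_mult_distrib sum_distrib_left
    by (intro sum.cong refl) (simp only: mult_ac)
  finally show ?thesis .
qed

text \<open>Turns inequalities between samples at \<open>u + k * h\<close> into inequalities between
  integrals, by integrating over \<open>u\<close>.\<close>

lemma integral_blocks:
  fixes f :: "real \<Rightarrow> real"
  assumes "\<And>s t. f integrable_on {s..t}" "0 \<le> h"
  shows "integral {0..real N * h} f = (\<Sum>k<N. integral {0..h} (\<lambda>u. f (u + real k * h)))"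
proof (induction N)
  case 0
  then show ?case by simp
next
  case (Suc N)
  have "integral {0..h} (\<lambda>u. f (u + real N * h)) = integral {real N * h..real (Suc N) * h} f"
    using integral_shift_Icc_real[of 0 h f "real N * h"] by (simp add: o_def algebra_simps)
  moreover have "integral {0..real N * h} f + integral {real N * h..real (Suc N) * h} f
      = integral {0..real (Suc N) * h} f"
    by (intro Henstock_Kurzweil_Integration.integral_combine assms(1)) (use assms(2) in \<open>auto simp: mult_right_mono\<close>)
  ultimately show ?case using Suc by simp
qed

lemma exp_nine_quarters: "16/9 * exp (-9/4 :: real) \<le> 1/5"
proof -
  \<comment> \<open>The goal amounts to \<open>80/9 \<le> exp (9/4)\<close>. The quadratic Taylor
    bound is too weak at 9/4, so it is taken at 1/4 and raised to the ninth power.\<close>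
  have "1 + 1/4 + (1/4)\<^sup>2/2 \<le> exp (1/4 :: real)" by (rule exp_lower_Taylor_quadratic) simp
  then have "(41/32) ^ 9 \<le> exp (1/4 :: real) ^ 9"
    by (intro power_mono) (auto simp: power2_eq_square)
  also have "\<dots> = exp (9/4)" by (simp flip: exp_of_nat_mult)
  finally have "80/9 \<le> exp (9/4 :: real)" by (rule order_trans[rotated]) (simp add: power_divide)
  then show ?thesis by (simp add: exp_minus field_simps)
qed

text \<open>The unit interval is \<open>4 * n\<close> blocks of length \<open>h\<close>. Later
  blocks are dominated by a geometric series of ratio 1/5, whose sum is the factor 5/4.\<close>

lemma weighted_integral_growth:
  fixes n :: nat and a :: "nat \<Rightarrow> complex" and lam :: "nat \<Rightarrow> real"
  assumes "n \<ge> 1" and h: "h = 1 / (4 * real n)"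
  defines "W \<equiv> weighted_square n a lam"
  shows "integral {0..real (4 * n + i) * h} W \<le> (1 + 5/4 * (64/125) ^ n) * integral {0..1} W"
proof -
  define J where "J k = integral {0..h} (\<lambda>u. W (u + real k * h))" for k
  define I where "I = integral {0..1} W"
  have int: "W integrable_on {s..t}" for s t
    unfolding W_def by (rule integrable_weighted_square)
  have shift_int: "(\<lambda>u. W (u + real k * h)) integrable_on {0..h}" for k
    unfolding W_def by (intro integrable_continuous_interval
        continuous_on_compose2[OF continuous_on_weighted_square[of UNIV]] continuous_intros subset_UNIV)
  have h0: "0 \<le> h" using h by simp
  have W0: "0 \<le> W t" for t unfolding W_def by (rule weighted_square_nonneg)
  have blocks: "integral {0..real N * h} W = (\<Sum>k<N. J k)" for N
    unfolding J_def by (rule integral_blocks[OF int h0])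
  have I: "(\<Sum>k<4 * n. J k) = I"
    unfolding blocks[symmetric] I_def using assms(1) h by simp
  have J0: "0 \<le> J k" for k
    unfolding J_def by (intro integral_nonneg shift_int W0)
  have "(\<Sum>k<n. J k) \<le> (\<Sum>k<4 * n. J k)" using J0 by (intro sum_mono2) auto
  then have J_n: "(\<Sum>k<n. J k) \<le> I" by (simp add: I)
  have I0: "0 \<le> I" using I sum_nonneg[of "{..<4 * n}" J] J0 by simp
  have J_le: "J (4 * n + i) \<le> (64/125) ^ n * (1/5) ^ i * I" for i
  proof -
    let ?q = "16/9 * exp (-9/4 :: real)"
    \<comment> \<open>Extrapolating from the first \<open>n\<close> blocks passes over
      \<open>3 * n\<close> further blocks inside the unit interval; their decay
      \<open>(1/5) ^ (3 * n)\<close> outweighs \<open>64 ^ n\<close>, giving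
      \<open>(64/125) ^ n\<close>.\<close>
    have "J (n + (3 * n + i)) \<le> integral {0..h} (\<lambda>u. 64 ^ n * ?q ^ (3 * n + i) * (\<Sum>k<n. W (u + real k * h)))"
      unfolding J_def
    proof (rule integral_le[OF shift_int])
      show "(\<lambda>u. 64 ^ n * ?q ^ (3 * n + i) * (\<Sum>k<n. W (u + real k * h))) integrable_on {0..h}"
        by (intro integrable_on_mult_right integrable_sum shift_int finite_lessThan)
      fix u assume "u \<in> {0..h}"
      then show "W (u + real (n + (3 * n + i)) * h) \<le> 64 ^ n * ?q ^ (3 * n + i) * (\<Sum>k<n. W (u + real k * h))"
        unfolding W_def by (intro weighted_square_extrapolation assms) simp
    qed
    also have "\<dots> = 64 ^ n * ?q ^ (3 * n + i) * (\<Sum>k<n. J k)"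
      by (simp add: J_def integral_sum[OF finite_lessThan] shift_int)
    also have "\<dots> \<le> 64 ^ n * (1/5) ^ (3 * n + i) * I"
      using J_n J0 exp_nine_quarters by (intro mult_mono power_mono sum_nonneg) auto
    also have "\<dots> = (64 ^ n * ((1/5) ^ 3) ^ n) * (1/5) ^ i * I"
      by (simp only: power_add power_mult)
    also have "64 ^ n * ((1/5) ^ 3) ^ n = (64/125 :: real) ^ n"
      by (simp add: power_mult_distrib[symmetric] power_divide)
    finally show ?thesis by (simp add: algebra_simps)
  qed
  have "(\<Sum>k<4 * n + i. J k) \<le> I + 5/4 * (64/125) ^ n * (1 - (1/5) ^ i) * I" for i
  proof (induction i)
    case 0
    then show ?case by (simp add: I)
  next
    case (Suc i)
    have telescope: "I + 5/4 * P * (1 - Q) * I + P * Q * I = I + 5/4 * P * (1 - 1/5 * Q) * I"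
      for P Q :: real
      by (simp add: field_simps)
    have "(\<Sum>k<4 * n + Suc i. J k) = (\<Sum>k<4 * n + i. J k) + J (4 * n + i)" by simp
    also have "\<dots> \<le> I + 5/4 * (64/125) ^ n * (1 - (1/5) ^ i) * I + (64/125) ^ n * (1/5) ^ i * I"
      by (intro add_mono Suc J_le)
    finally show ?case by (simp only: telescope power_Suc)
  qed
  also have "I + 5/4 * (64/125) ^ n * (1 - (1/5) ^ i) * I \<le> I + 5/4 * (64/125) ^ n * 1 * I" for i
    using I0 by (intro add_left_mono mult_right_mono mult_left_mono) auto
  finally show ?thesis unfolding blocks I_def[symmetric] by (simp add: algebra_simps)
qed

section \<open>The upper bound and its sharpness\<close>

lemma weighted_square_eq_exp_sum:
  "weighted_square n a lam t =
    (cmod (\<Sum>j<n. a j * exp (- Complex (9 * real n / 2) (- lam j) * of_real t)))\<^sup>2"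
proof -
  have "(\<Sum>j<n. a j * exp (- Complex (9 * real n / 2) (- lam j) * of_real t))
      = expsum n a lam t * complex_of_real (exp (- 9 * real n / 2 * t))"
    unfolding expsum_def sum_distrib_right mult.assoc exp_of_real[symmetric] exp_add[symmetric]
    by (intro sum.cong refl arg_cong2[where f = "(*)"] arg_cong[where f = exp]) (simp add: complex_eq_iff)
  moreover have "(exp (- 9 * real n / 2 * t))\<^sup>2 = exp (- 9 * real n * t)"
    by (simp add: power2_eq_square flip: exp_add)
  ultimately show ?thesis by (simp add: weighted_square_def norm_mult power_mult_distrib)
qed

lemma integral_weighted_square_tendsto:
  assumes "n \<ge> 1"
  shows "((\<lambda>T. integral {0..T} (weighted_square n a lam))
    \<longlongrightarrow> Re (cauchy_form (\<lambda>j. Complex (9 * real n / 2) (- lam j)) n a)) at_top"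
  unfolding weighted_square_eq_exp_sum[abs_def]
  by (rule integral_norm_square_exp_sum_tendsto) (use assms in simp)

lemma wnorm_expsum: "wnorm n (expsum n a lam) = sqrt (integral {0..1} (weighted_square n a lam))"
  by (simp add: wnorm_def weighted_square_def[abs_def])

lemma expsum_upper_bound:
  assumes "n \<ge> 1"
  shows "cmod (expsum n a lam 0) \<le> (1 + eps n) * (3 * real n) * wnorm n (expsum n a lam)"
proof -
  define h where "h = 1 / (4 * real n)"
  define I where "I = integral {0..1} (weighted_square n a lam)"
  define p where "p j = Complex (9 * real n / 2) (- lam j)" for j
  have I0: "0 \<le> I"
    unfolding I_def by (intro integral_nonneg integrable_weighted_square weighted_square_nonneg)
  \<comment> \<open>The half-line is exhausted along the block ends \<open>1 + i * h\<close>, where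
    the growth bound is uniform in \<open>i\<close>.\<close>
  have "filterlim (\<lambda>i. real (4 * n + i) * h) at_top sequentially"
    using assms by (intro filterlim_at_top_mult_tendsto_pos[OF tendsto_const]
        filterlim_compose[OF filterlim_real_sequentially] filterlim_subseq strict_monoI)
      (simp_all add: h_def)
  then have "(\<lambda>i. integral {0..real (4 * n + i) * h} (weighted_square n a lam))
      \<longlonglongrightarrow> Re (cauchy_form p n a)"
    unfolding p_def by (rule filterlim_compose[OF integral_weighted_square_tendsto[OF assms]])
  then have form: "Re (cauchy_form p n a) \<le> (1 + 5/4 * (64/125) ^ n) * I"
    unfolding I_def
    by (rule LIMSEQ_le_const2) (use weighted_integral_growth[OF assms h_def] in blast)
  \<comment> \<open>The chain \<open>64/125 \<le> 9/10 \<le> exp (- 1/10)\<close> puts the tail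
    factor below the excess in \<open>eps\<close>, with much room in the constant 8190.\<close>
  have "(64/125) ^ n \<le> (1 - 1/10 :: real) ^ n" by (intro power_mono) auto
  also have "\<dots> \<le> exp (- 1/10) ^ n"
    using exp_ge_add_one_self[of "-1/10"] by (intro power_mono) auto
  also have "\<dots> = exp (- real n / 10)" by (simp flip: exp_of_nat_mult)
  finally have "5/4 * (64/125) ^ n \<le> 8190 * exp (- real n / 10)"
    using exp_gt_zero[of "- real n / 10"] by linarith
  then have K: "1 + 5/4 * (64/125) ^ n \<le> (1 + eps n)\<^sup>2" by (simp add: eps_def)
  have p_pos: "0 < Re (p j)" for j using assms by (simp add: p_def)
  have "(cmod (expsum n a lam 0))\<^sup>2 = (cmod (\<Sum>j<n. a j))\<^sup>2" by (simp add: expsum_def)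
  also have "\<dots> \<le> (\<Sum>j<n. 2 * Re (p j)) * Re (cauchy_form p n a)"
    using cauchy_form_bound[of p n a] p_pos by blast
  also have "(\<Sum>j<n. 2 * Re (p j)) = (3 * real n)\<^sup>2"
    by (simp add: p_def power2_eq_square)
  also have "(3 * real n)\<^sup>2 * Re (cauchy_form p n a) \<le> (3 * real n)\<^sup>2 * ((1 + eps n)\<^sup>2 * I)"
    using form K I0 by (intro mult_left_mono) (auto intro: order_trans mult_right_mono)
  also have "\<dots> = ((1 + eps n) * (3 * real n) * wnorm n (expsum n a lam))\<^sup>2"
    unfolding wnorm_expsum I_def[symmetric] power_mult_distrib using I0 by simp
  finally show ?thesis
    by (rule power2_le_imp_le) (use I0 in \<open>simp add: wnorm_expsum I_def eps_def\<close>)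
qed

text \<open>For the half-line extremal, \<open>f(0)\<close> and the full squared norm both equal
  \<open>S = 9 * n\<^sup>2\<close>. Its mass on \<open>[1,2]\<close> is positive, so the squared
  norm over \<open>[0,1]\<close> is strictly below \<open>S\<close>.\<close>

lemma expsum_lower_bound:
  assumes "n \<ge> 1" and lam: "\<forall>j k. j < k \<longrightarrow> k < n \<longrightarrow> lam j < lam k"
  shows "\<exists>a. cmod (expsum n a lam 0) > 3 * real n * wnorm n (expsum n a lam)"
proof -
  define p where "p j = Complex (9 * real n / 2) (- lam j)" for j
  define S where "S = (3 * real n)\<^sup>2"
  have S: "(\<Sum>j<n. 2 * Re (p j)) = S" by (simp add: p_def S_def power2_eq_square)
  have "inj_on p {..<n}"
  proof (rule inj_onI)
    fix j k assume "j \<in> {..<n}" "k \<in> {..<n}" "p j = p k"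
    then have "j < n" "k < n" "lam j = lam k" by (simp_all add: p_def)
    then show "j = k" using lam by (metis less_irrefl linorder_neqE_nat)
  qed
  moreover have "0 < Re (p j)" for j using assms by (simp add: p_def)
  ultimately obtain a where a: "(\<Sum>j<n. a j) = complex_of_real S" "cauchy_form p n a = complex_of_real S"
    using cauchy_form_extremal[of p n] unfolding S by blast
  define W where "W = weighted_square n a lam"
  have int: "W integrable_on {s..t}" for s t
    unfolding W_def by (rule integrable_weighted_square)
  have W0: "0 \<le> W t" for t unfolding W_def by (rule weighted_square_nonneg)
  have f0: "expsum n a lam 0 = complex_of_real S" using a by (simp add: expsum_def)
  have S_pos: "S > 0" using assms by (simp add: S_def)
  \<comment> \<open>Extrapolating backwards from \<open>2\<close> with step \<open>1/n\<close>, vanishing of \<open>f\<close> on \<open>[1,2]\<close> would force \<open>f(0) = 0\<close>.\<close>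
  have "\<exists>t\<in>{1..2}. W t \<noteq> 0"
  proof (rule ccontr)
    assume "\<not> ?thesis"
    then have zero: "expsum n a lam t = 0" if "t \<in> {1..2}" for t
      using that by (auto simp: W_def weighted_square_def)
    have "(cmod (expsum n a lam (2 + real (n + n) * (- 1 / real n))))\<^sup>2
      \<le> 64 ^ n * (16/9) ^ n * (\<Sum>k<n. (cmod (expsum n a lam (2 + real k * (- 1 / real n))))\<^sup>2)"
      by (rule expsum_extrapolation)
    also have "(\<Sum>k<n. (cmod (expsum n a lam (2 + real k * (- 1 / real n))))\<^sup>2) = 0"
      by (rule sum.neutral) (use zero in \<open>auto simp: field_simps\<close>)
    also have "2 + real (n + n) * (- 1 / real n) = 0" using assms by (simp add: field_simps)
    finally show False using f0 S_pos by simp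
  qed
  then have "integral {1..2} W \<noteq> 0"
    using integral_eq_0_iff[of 1 2 W] continuous_on_weighted_square W0 by (auto simp: W_def)
  moreover have "0 \<le> integral {1..2} W" by (intro integral_nonneg int W0)
  ultimately have pos: "0 < integral {1..2} W" by simp
  have "integral {0..1} W + integral {1..2} W = integral {0..2} W"
    by (intro Henstock_Kurzweil_Integration.integral_combine int) auto
  moreover have "integral {0..2} W \<le> Re (cauchy_form p n a)"
    unfolding p_def W_def
  proof (rule tendsto_lowerbound[OF integral_weighted_square_tendsto[OF assms(1)]])
    show "\<forall>\<^sub>F T in at_top. integral {0..2} (weighted_square n a lam) \<le> integral {0..T} (weighted_square n a lam)"
      using eventually_ge_at_top[of 2]
      by eventually_elim (auto intro!: integral_subset_le integrable_weighted_square weighted_square_nonneg)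
  qed simp
  ultimately have "integral {0..1} W < S" using pos a by simp
  then have "3 * real n * wnorm n (expsum n a lam) < 3 * real n * sqrt S"
    using assms by (simp add: wnorm_expsum W_def)
  also have "sqrt S = 3 * real n" unfolding S_def by (rule real_sqrt_unique) simp_all
  also have "3 * real n * (3 * real n) = cmod (expsum n a lam 0)"
    unfolding f0 norm_of_real by (simp add: S_def power2_eq_square)
  finally show ?thesis by blast
qed

theorem theorem3p2:
  fixes n :: nat
  assumes "n \<ge> 1"
  shows "(\<forall>(lam :: nat \<Rightarrow> real) (a :: nat \<Rightarrow> complex).
            (\<forall>j k. j < k \<longrightarrow> k < n \<longrightarrow> lam j < lam k) \<longrightarrow>
            cmod (expsum n a lam 0) \<le> (1 + eps n) * (3 * real n) * wnorm n (expsum n a lam))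
       \<and> (\<forall>(lam :: nat \<Rightarrow> real). (\<forall>j k. j < k \<longrightarrow> k < n \<longrightarrow> lam j < lam k) \<longrightarrow>
            (\<exists>a :: nat \<Rightarrow> complex.
               cmod (expsum n a lam 0) > 3 * real n * wnorm n (expsum n a lam)))"
  using expsum_upper_bound[OF assms] expsum_lower_bound[OF assms] by blast

end
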